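(* For $|q|<1$ (equivalently, as formal power series in $q$), $$\sum_{\lambda\in\mathcal{P}_1}q^{|\lambda|}=1+\sum_{n=1}^{\infty}\frac{(-q;q^4)_{n-1}\,q^{2n}(1+q^{2n-3})}{(q^2;q^2)_{n}}=\frac{1}{(q,q^4,q^5,q^6,q^8;q^8)_{\infty}}.$$
   Context: A partition is a finite weakly decreasing sequence of positive integers $\lambda=(\lambda_1,\ldots,\lambda_\ell)$ (the empty partition is included), of length $\ell(\lambda)=\ell$ and weight $|\lambda|=\lambda_1+\cdots+\lambda_\ell$. $\mathcal{P}_1$ is the set of partitions such that for all $1\le i<\ell(\lambda)$, $\lambda_i-\lambda_{i+1}\geq3$ if $\lambda_{i+1}$ is odd (the empty partition belongs to it). Notation: $(a;q)_0=1$, $(a;q)_n=\prod_{i=0}^{n-1}(1-aq^i)$, $(a;q)_\infty=\lim_{n\to\infty}(a;q)_n$, and $(a_1,\ldots,a_k;q)_\infty=(a_1;q)_\infty\cdots(a_k;q)_\infty$. Negative powers of $q$ (occurring for $n=1$) cancel against the factor $q^{2n}$. *)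

theory Defs
  imports "HOL-Analysis.Analysis"
begin

definition partitions :: "nat list set" where
  "partitions = {l. sorted_wrt (\<ge>) l \<and> (\<forall>x\<in>set l. 0 < x)}"

definition P1 :: "nat list set" where
  "P1 = {l \<in> partitions. \<forall>i. i + 1 < length l \<longrightarrow> odd (l ! (i + 1)) \<longrightarrow> l ! i - l ! (i + 1) \<ge> 3}"

definition qpoch :: "complex \<Rightarrow> complex \<Rightarrow> nat \<Rightarrow> complex" where
  "qpoch a q n = (\<Prod>i<n. 1 - a * q ^ i)"

definition qpoch_inf :: "complex \<Rightarrow> complex \<Rightarrow> complex" where
  "qpoch_inf a q = lim (\<lambda>n. qpoch a q n)"

definition qpoch_inf_list :: "complex list \<Rightarrow> complex \<Rightarrow> complex" where
  "qpoch_inf_list as q = (\<Prod>a\<leftarrow>as. qpoch_inf a q)"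

lemma qpoch_tendsto_qpoch_inf:
  assumes "norm q < 1"
  shows "(\<lambda>n. qpoch a q n) \<longlonglongrightarrow> qpoch_inf a q"
proof -
  have "summable (\<lambda>i. norm (- (a * q ^ i)))"
    using assms by (simp add: norm_mult norm_power summable_mult summable_geometric)
  then have "summable (\<lambda>i. norm ((1 - a * q ^ i) - 1))"
    by simp
  then have "convergent_prod (\<lambda>i. 1 - a * q ^ i)"
    by (intro abs_convergent_prod_imp_convergent_prod summable_imp_abs_convergent_prod)
  then have "convergent (\<lambda>n. \<Prod>i\<le>n. 1 - a * q ^ i)"
    by (auto dest: convergent_prod_imp_convergent)
  then obtain L where "(\<lambda>n. \<Prod>i\<le>n. 1 - a * q ^ i) \<longlonglongrightarrow> L"
    by (auto simp: convergent_def)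
  then have "(\<lambda>n. qpoch a q (Suc n)) \<longlonglongrightarrow> L"
    by (simp only: qpoch_def lessThan_Suc_atMost)
  then have "(\<lambda>n. qpoch a q n) \<longlonglongrightarrow> L"
    by (rule LIMSEQ_imp_Suc)
  then show ?thesis
    unfolding qpoch_inf_def by (metis limI)
qed

end

theory Submission
  imports Defs
begin

text \<open>
  Read a partition in \<open>P1\<close> from its smallest part upwards, and write \<open>m'\<close> for \<open>m\<close> if \<open>m\<close> is even
  and for \<open>m + 3\<close> if \<open>m\<close> is odd. Above a part \<open>m\<close> the next part may be any number
  \<open>\<ge> m'\<close>. As \<open>m'\<close> is always even, summing over the next part and separating its two
  parities gives by induction that the chains of \<open>n\<close> parts above \<open>m\<close> have generating function
  \<open>q\<^bsup>n m'\<^esup> W\<^sub>n\<close> with \<open>W\<^sub>n = (-q;q\<^sup>4)\<^sub>n / (q\<^sup>2;q\<^sup>2)\<^sub>n\<close>. For \<open>m = 0\<close> such a chain is a member of \<open>P1\<close> with at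
  most \<open>n\<close> parts, padded by zeros. Hence the partitions with exactly \<open>n\<close> parts contribute
  \<open>W\<^sub>n - W\<^sub>n\<^sub>-\<^sub>1\<close>, which is the \<open>n\<close>-th term of the series, and everything converges to
  \<open>(-q;q\<^sup>4)\<^sub>\<infinity> / (q\<^sup>2;q\<^sup>2)\<^sub>\<infinity>\<close>. Finally \<open>(-q;q\<^sup>4)\<^sub>\<infinity> (q;q\<^sup>4)\<^sub>\<infinity> = (q\<^sup>2;q\<^sup>8)\<^sub>\<infinity>\<close>.
\<close>

section \<open>Chains with the gap condition and their generating functions\<close>

definition next_even :: "nat \<Rightarrow> nat" where
  "next_even m = (if even m then m else m + 3)"

lemma even_next_even: "even (next_even m)"
  by (simp add: next_even_def)

lemma le_next_even: "m \<le> next_even m"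
  by (simp add: next_even_def)

text \<open>The lists run upwards, opposite to the partitions. The bound \<open>m\<close> is not
  itself an entry, and for \<open>m = 0\<close> entries equal to 0 are allowed.\<close>

definition gap_chains :: "nat \<Rightarrow> nat \<Rightarrow> nat list set" where
  "gap_chains n m = {xs. length xs = n \<and> successively (\<lambda>a b. next_even a \<le> b) (m # xs)}"

lemma gap_chains_0: "gap_chains 0 m = {[]}"
  by (auto simp: gap_chains_def)

lemma Cons_in_gap_chains_Suc:
  "k # xs \<in> gap_chains (Suc n) m \<longleftrightarrow> next_even m \<le> k \<and> xs \<in> gap_chains n k"
  by (auto simp: gap_chains_def)

lemma bij_betw_gap_chains_Suc:
  "bij_betw (\<lambda>(k, xs). k # xs) (Sigma {next_even m..} (gap_chains n)) (gap_chains (Suc n) m)"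
proof (intro bij_betw_imageI)
  show "(\<lambda>(k, xs). k # xs) ` Sigma {next_even m..} (gap_chains n) = gap_chains (Suc n) m"
  proof (intro equalityI subsetI)
    fix ys assume ys: "ys \<in> gap_chains (Suc n) m"
    then obtain k xs where "ys = k # xs"
      by (cases ys) (auto simp: gap_chains_def)
    with ys show "ys \<in> (\<lambda>(k, xs). k # xs) ` Sigma {next_even m..} (gap_chains n)"
      by (auto simp: Cons_in_gap_chains_Suc image_iff)
  qed (auto simp: Cons_in_gap_chains_Suc)
qed (auto simp: inj_on_def)

text \<open>The field is left general so that a complex \<open>q\<close> as well as its real norm,
  used for absolute convergence, can be inserted.\<close>

definition chain_weight :: "'a::real_normed_field \<Rightarrow> nat \<Rightarrow> 'a" where
  "chain_weight q n = (\<Prod>i<n. (1 + q ^ (4 * i + 1)) / (1 - q ^ (2 * i + 2)))"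

lemma has_sum_atLeast_even:
  fixes f :: "nat \<Rightarrow> 'a::{real_normed_field, banach}"
  assumes "even M"
    and "((\<lambda>j. f (M + 2 * j)) has_sum a) UNIV" and "((\<lambda>j. f (M + 2 * j + 1)) has_sum b) UNIV"
  shows "(f has_sum (a + b)) {M..}"
proof -
  have e: "(f has_sum a) {k. M \<le> k \<and> even k}"
    using assms(2)
    by (subst has_sum_reindex_bij_witness
          [where i = "\<lambda>j. M + 2 * j" and j = "\<lambda>k. (k - M) div 2" and T = UNIV and g = f])
       (use assms(1) in auto)
  have half: "M + 2 * ((k - M) div 2) + 1 = k" if "M \<le> k" "odd k" for k
    using that assms(1) by presburger
  have o: "(f has_sum b) {k. M \<le> k \<and> odd k}"
    using assms(3)
    by (subst has_sum_reindex_bij_witness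
          [where i = "\<lambda>j. M + 2 * j + 1" and j = "\<lambda>k. (k - M) div 2" and T = UNIV and g = f])
       (use assms(1) half in auto)
  have "{M..} = {k. M \<le> k \<and> even k} \<union> {k. M \<le> k \<and> odd k}"
    by auto
  with has_sum_Un_disjoint[OF e o] show ?thesis
    by auto
qed

lemma has_sum_geometric_mult:
  fixes z c :: "'a::{real_normed_field, banach}"
  assumes "norm z < 1"
  shows "((\<lambda>j. c * z ^ j) has_sum (c / (1 - z))) UNIV"
proof -
  have "((\<lambda>j. z ^ j) has_sum (1 / (1 - z))) UNIV"
    using assms
    by (intro norm_summable_imp_has_sum geometric_sums) (auto simp: norm_power)
  then show ?thesis
    by (auto dest: has_sum_cmult_right[of _ _ _ c])
qed

text \<open>Brings a summand into geometric form in \<open>j\<close>, so that only an identity of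
  exponents remains to be checked.\<close>

lemma power_mult_regroup:
  fixes x w :: "'a::comm_monoid_mult"
  assumes "a + b = c + d * j"
  shows "x ^ a * (x ^ b * w) = x ^ c * w * (x ^ d) ^ j"
proof -
  have "x ^ a * (x ^ b * w) = x ^ (a + b) * w"
    by (simp add: power_add mult.assoc)
  also have "\<dots> = x ^ c * w * (x ^ d) ^ j"
    unfolding assms by (simp add: power_add power_mult mult_ac)
  finally show ?thesis .
qed

text \<open>The induction step for chains: \<open>k\<close> is the smallest of \<open>Suc n\<close>
  parts. Even \<open>k\<close> and odd \<open>k\<close> each give a geometric series with ratio
  \<open>q ^ (2 * n + 2)\<close>.\<close>

lemma has_sum_chain_weight_step:
  fixes q :: "'a::{real_normed_field, banach}"
  assumes "norm q < 1"
  shows "((\<lambda>k. q ^ k * (q ^ (n * next_even k) * chain_weight q n)) has_sum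
           (q ^ (Suc n * next_even m) * chain_weight q (Suc n))) {next_even m..}"
proof -
  let ?M = "next_even m" and ?W = "chain_weight q n"
  let ?z = "q ^ (2 * n + 2)"
  have z: "norm ?z < 1"
    using assms by (simp add: norm_power power_less_one_iff del: power_Suc)
  have "((\<lambda>k. q ^ k * (q ^ (n * next_even k) * ?W)) has_sum
      (q ^ (Suc n * ?M) * ?W / (1 - ?z) + q ^ (Suc n * ?M + 4 * n + 1) * ?W / (1 - ?z))) {?M..}"
  proof (rule has_sum_atLeast_even)
    have "q ^ (?M + 2 * j) * (q ^ (n * next_even (?M + 2 * j)) * ?W)
        = q ^ (Suc n * ?M) * ?W * ?z ^ j" for j
    proof -
      have "next_even (?M + 2 * j) = ?M + 2 * j"
        using even_next_even[of m] by (simp add: next_even_def[of "?M + 2 * j"])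
      moreover have "(?M + 2 * j) + n * (?M + 2 * j) = Suc n * ?M + (2 * n + 2) * j"
        by (simp add: algebra_simps)
      ultimately show ?thesis
        by (simp only: power_mult_regroup)
    qed
    then show "((\<lambda>j. q ^ (?M + 2 * j) * (q ^ (n * next_even (?M + 2 * j)) * ?W)) has_sum
        (q ^ (Suc n * ?M) * ?W / (1 - ?z))) UNIV"
      using has_sum_geometric_mult[OF z] by presburger
    have "q ^ (?M + 2 * j + 1) * (q ^ (n * next_even (?M + 2 * j + 1)) * ?W)
        = q ^ (Suc n * ?M + 4 * n + 1) * ?W * ?z ^ j" for j
    proof -
      \<comment> \<open>Compared with the even part just below, the odd part adds 1 to the exponent
        and raises the bound for each of the \<open>n\<close> parts above it by 4. This is the
        source of \<open>4 * n + 1\<close>.\<close>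
      have "next_even (?M + 2 * j + 1) = ?M + 2 * j + 4"
        using even_next_even[of m] by (simp add: next_even_def[of "Suc (?M + 2 * j)"])
      moreover have "(?M + 2 * j + 1) + n * (?M + 2 * j + 4)
          = (Suc n * ?M + 4 * n + 1) + (2 * n + 2) * j"
        by (simp add: algebra_simps)
      ultimately show ?thesis
        by (simp only: power_mult_regroup)
    qed
    then show "((\<lambda>j. q ^ (?M + 2 * j + 1) * (q ^ (n * next_even (?M + 2 * j + 1)) * ?W)) has_sum
        (q ^ (Suc n * ?M + 4 * n + 1) * ?W / (1 - ?z))) UNIV"
      using has_sum_geometric_mult[OF z] by presburger
  qed (rule even_next_even)
  \<comment> \<open>The two parities combine to the factor with index \<open>n\<close> in
    \<open>chain_weight q (Suc n)\<close>.\<close>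
  also have "q ^ (Suc n * ?M) * ?W / (1 - ?z) + q ^ (Suc n * ?M + 4 * n + 1) * ?W / (1 - ?z)
      = q ^ (Suc n * ?M) * (?W * ((1 + q ^ (4 * n + 1)) / (1 - ?z)))"
    by (simp add: add_divide_distrib power_add algebra_simps)
  finally show ?thesis
    by (simp add: chain_weight_def)
qed

lemma summable_on_norm_power:
  fixes q :: "'a::{real_normed_field, banach}"
  assumes "(\<lambda>x. norm q ^ w x) summable_on A"
  shows "(\<lambda>x. q ^ w x) summable_on A"
  by (rule abs_summable_summable) (use assms in \<open>simp add: norm_power\<close>)

text \<open>Induction by splitting off the smallest part. As the terms are nonnegative, summability
  of the inner sums and then of their values gives summability over all pairs.\<close>

lemma has_sum_gap_chains_real:
  fixes r :: real
  assumes "0 \<le> r" "r < 1"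
  shows "((\<lambda>xs. r ^ sum_list xs) has_sum (r ^ (n * next_even m) * chain_weight r n)) (gap_chains n m)"
proof (induction n arbitrary: m)
  case 0
  show ?case
    by (simp add: gap_chains_0 chain_weight_def has_sum_finiteI)
next
  case (Suc n)
  let ?f = "\<lambda>(k, xs). r ^ k * r ^ sum_list xs"
  have inner: "((\<lambda>xs. ?f (k, xs)) has_sum (r ^ k * (r ^ (n * next_even k) * chain_weight r n)))
      (gap_chains n k)" for k
    using has_sum_cmult_right[OF Suc.IH] by simp
  have step: "((\<lambda>k. r ^ k * (r ^ (n * next_even k) * chain_weight r n)) has_sum
      (r ^ (Suc n * next_even m) * chain_weight r (Suc n))) {next_even m..}"
    using assms by (intro has_sum_chain_weight_step) auto
  have "(?f has_sum (r ^ (Suc n * next_even m) * chain_weight r (Suc n)))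
      (Sigma {next_even m..} (gap_chains n))"
    using assms(1)
    by (intro has_sum_SigmaI[OF inner step]
          summable_on_SigmaI[OF inner has_sum_imp_summable[OF step]]) auto
  then show ?case
    by (subst has_sum_reindex_bij_betw[OF bij_betw_gap_chains_Suc, symmetric])
       (simp add: case_prod_unfold power_add)
qed

text \<open>The same induction, except that summability over the pairs is now inherited from the
  real case at \<open>norm q\<close>.\<close>

lemma has_sum_gap_chains:
  fixes q :: "'a::{real_normed_field, banach}"
  assumes "norm q < 1"
  shows "((\<lambda>xs. q ^ sum_list xs) has_sum (q ^ (n * next_even m) * chain_weight q n)) (gap_chains n m)"
proof (induction n arbitrary: m)
  case 0
  show ?case
    by (simp add: gap_chains_0 chain_weight_def has_sum_finiteI)
next
  case (Suc n)
  let ?f = "\<lambda>(k, xs). q ^ k * q ^ sum_list xs"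
  have inner: "((\<lambda>xs. ?f (k, xs)) has_sum (q ^ k * (q ^ (n * next_even k) * chain_weight q n)))
      (gap_chains n k)" for k
    using has_sum_cmult_right[OF Suc.IH] by simp
  have "(\<lambda>xs. q ^ sum_list xs) summable_on gap_chains (Suc n) m"
    by (rule summable_on_norm_power)
       (rule has_sum_imp_summable[OF has_sum_gap_chains_real[OF norm_ge_zero assms]])
  then have "?f summable_on Sigma {next_even m..} (gap_chains n)"
    by (subst (asm) summable_on_reindex_bij_betw[OF bij_betw_gap_chains_Suc, symmetric])
       (simp add: case_prod_unfold power_add)
  then have "(?f has_sum (q ^ (Suc n * next_even m) * chain_weight q (Suc n)))
      (Sigma {next_even m..} (gap_chains n))"
    by (rule has_sum_SigmaI[OF inner has_sum_chain_weight_step[OF assms]])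
  then show ?case
    by (subst has_sum_reindex_bij_betw[OF bij_betw_gap_chains_Suc, symmetric])
       (simp add: case_prod_unfold power_add)
qed

section \<open>Partitions with an exact number of parts\<close>

definition positive_chains :: "nat \<Rightarrow> nat list set" where
  "positive_chains n = {xs \<in> gap_chains n 0. 0 \<notin> set xs}"

definition exact_weight :: "'a::real_normed_field \<Rightarrow> nat \<Rightarrow> 'a" where
  "exact_weight q n = (case n of 0 \<Rightarrow> 1 | Suc k \<Rightarrow> chain_weight q (Suc k) - chain_weight q k)"

text \<open>Telescoping: the limit of \<open>chain_weight\<close> thereby becomes the value of the
  series of exact weights.\<close>

lemma sum_exact_weight: "(\<Sum>i<Suc n. exact_weight q i) = chain_weight q n"
  by (subst sum.lessThan_Suc_shift)
     (simp add: exact_weight_def sum_lessThan_telescope chain_weight_def[of q 0])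

lemma gap_chains_lower_bound: "xs \<in> gap_chains n m \<Longrightarrow> x \<in> set xs \<Longrightarrow> m \<le> x"
proof (induction xs arbitrary: n m)
  case (Cons k xs)
  then obtain n' where n: "n = Suc n'"
    by (auto simp: gap_chains_def)
  with Cons.prems have k: "next_even m \<le> k" "xs \<in> gap_chains n' k"
    by (auto simp: Cons_in_gap_chains_Suc)
  with Cons.prems(2) Cons.IH[OF k(2)] le_next_even[of m] show ?case
    by auto
qed simp

text \<open>Chains increase weakly, so 0 occurs only if it is the first entry; what follows it is
  then an arbitrary chain above 0.\<close>

lemma positive_chains_Suc: "positive_chains (Suc n) = gap_chains (Suc n) 0 - (#) 0 ` gap_chains n 0"
proof (intro equalityI subsetI)
  fix ys assume ys: "ys \<in> gap_chains (Suc n) 0 - (#) 0 ` gap_chains n 0"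
  then obtain k xs where eq: "ys = k # xs"
    by (cases ys) (auto simp: gap_chains_def)
  with ys have "xs \<in> gap_chains n k" "k \<noteq> 0"
    by (auto simp: Cons_in_gap_chains_Suc)
  with gap_chains_lower_bound[of xs n k] ys eq show "ys \<in> positive_chains (Suc n)"
    by (auto simp: positive_chains_def)
qed (auto simp: positive_chains_def)

text \<open>Prefixing 0 is injective and keeps the sum of the entries, so the chains removed
  contribute the previous \<open>chain_weight\<close>.\<close>

lemma has_sum_positive_chains:
  fixes q :: "'a::{real_normed_field, banach}"
  assumes "norm q < 1"
  shows "((\<lambda>xs. q ^ sum_list xs) has_sum exact_weight q n) (positive_chains n)"
proof (cases n)
  case 0
  then have "positive_chains n = {[]}"
    by (auto simp: positive_chains_def gap_chains_0)
  with 0 show ?thesis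
    by (simp add: exact_weight_def has_sum_finiteI)
next
  case (Suc k)
  have all: "((\<lambda>xs. q ^ sum_list xs) has_sum chain_weight q n) (gap_chains n 0)" for n
    using has_sum_gap_chains[OF assms, of n 0] by (simp add: next_even_def)
  have "((\<lambda>xs. q ^ sum_list xs) has_sum chain_weight q k) ((#) 0 ` gap_chains k 0)"
    using all[of k] by (subst has_sum_reindex) (auto simp: o_def)
  moreover have "(#) 0 ` gap_chains k 0 \<subseteq> gap_chains (Suc k) 0"
    by (auto simp: Cons_in_gap_chains_Suc next_even_def)
  ultimately show ?thesis
    using has_sum_Diff[OF all[of "Suc k"]] Suc
    by (auto simp: positive_chains_Suc exact_weight_def)
qed

text \<open>Monotonicity and the gap condition merge into one relation between neighbours. Truncated
  subtraction is harmless, since a difference of at least 3 is a true difference.\<close>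

lemma P1_altdef: "P1 = {l. successively (\<lambda>a b. next_even b \<le> a) l \<and> 0 \<notin> set l}"
proof (intro equalityI subsetI)
  fix l assume "l \<in> P1"
  then have l: "sorted_wrt (\<ge>) l" "0 \<notin> set l"
    "\<And>i. i + 1 < length l \<Longrightarrow> odd (l ! (i + 1)) \<Longrightarrow> l ! i - l ! (i + 1) \<ge> 3"
    by (auto simp: P1_def partitions_def)
  have "next_even (l ! Suc i) \<le> l ! i" if "Suc i < length l" for i
    using sorted_wrt_nth_less[OF l(1), of i "Suc i"] l(3)[of i] that
    by (auto simp: next_even_def)
  with l(2) show "l \<in> {l. successively (\<lambda>a b. next_even b \<le> a) l \<and> 0 \<notin> set l}"
    by (simp add: successively_conv_nth)
next
  fix l assume "l \<in> {l. successively (\<lambda>a b. next_even b \<le> a) l \<and> 0 \<notin> set l}"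
  then have l: "successively (\<lambda>a b. next_even b \<le> a) l" "0 \<notin> set l"
    by auto
  have "successively (\<ge>) l"
    using l(1) by (rule successively_mono) (use le_next_even order_trans in blast)
  then have "sorted_wrt (\<ge>) l"
    by (subst (asm) successively_conv_sorted_wrt) (auto simp: transp_def)
  moreover have "l ! i - l ! (i + 1) \<ge> 3" if "i + 1 < length l" "odd (l ! (i + 1))" for i
    using l(1) that unfolding successively_conv_nth next_even_def by fastforce
  ultimately show "l \<in> P1"
    using l(2) by (auto simp: P1_def partitions_def intro: Nat.gr0I)
qed

text \<open>As \<open>next_even 0 = 0\<close>, the bound coming from the 0 in front of a chain holds
  for every first entry.\<close>

lemma rev_in_P1_iff: "rev xs \<in> P1 \<longleftrightarrow> xs \<in> positive_chains (length xs)"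
  by (auto simp: P1_altdef positive_chains_def gap_chains_def successively_Cons next_even_def)

lemma length_positive_chains: "xs \<in> positive_chains n \<Longrightarrow> length xs = n"
  by (simp add: positive_chains_def gap_chains_def)

lemma bij_betw_P1: "bij_betw (\<lambda>(n, xs). rev xs) (Sigma UNIV positive_chains) P1"
proof (rule bij_betwI[where g = "\<lambda>l. (length l, rev l)"])
  have "rev xs \<in> P1" if "xs \<in> positive_chains n" for n xs
    using that length_positive_chains[OF that] by (simp add: rev_in_P1_iff)
  then show "(\<lambda>(n, xs). rev xs) \<in> Sigma UNIV positive_chains \<rightarrow> P1"
    by auto
  show "(\<lambda>l. (length l, rev l)) \<in> P1 \<rightarrow> Sigma UNIV positive_chains"
    using rev_in_P1_iff[of "rev l" for l] by auto
qed (auto dest: length_positive_chains)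

section \<open>Finite and infinite q-products\<close>

lemma chain_weight_eq_qpoch:
  "chain_weight q n = qpoch (- q) (q ^ 4) n / qpoch (q ^ 2) (q ^ 2) n"
proof -
  have e: "q ^ (4 * i + 1) = q * (q ^ 4) ^ i" "q ^ (2 * i + 2) = q ^ 2 * (q ^ 2) ^ i" for i
    by (simp_all add: add.commute flip: power_mult power_add power_Suc)
  show ?thesis
    unfolding chain_weight_def qpoch_def e by (simp add: prod_dividef)
qed

lemma power_neq_1:
  fixes q :: complex
  assumes "norm q < 1" "n > 0"
  shows "q ^ n \<noteq> 1"
  using assms by (metis norm_one norm_power order_less_irrefl power_less_one_iff norm_ge_zero)

lemma qpoch_power_nonzero:
  assumes "norm q < 1" "k > 0"
  shows "qpoch (q ^ k) (q ^ m) n \<noteq> 0"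
  using power_neq_1[OF assms(1), of "k + m * i" for i] assms(2)
  by (simp add: qpoch_def power_add power_mult)

text \<open>A limit of nonzero partial products could still be 0. Absolute convergence excludes
  this, once the limit is identified with \<open>prodinf\<close>.\<close>

lemma qpoch_inf_power_nonzero:
  assumes q: "norm q < 1" and "k > 0" "m > 0"
  shows "qpoch_inf (q ^ k) (q ^ m) \<noteq> 0"
proof -
  have nz: "1 - q ^ k * (q ^ m) ^ i \<noteq> 0" for i
    using power_neq_1[OF q, of "k + m * i"] assms(2) by (simp add: power_add power_mult)
  have qm: "norm (q ^ m) < 1"
    using assms by (simp add: norm_power power_less_one_iff)
  then have "summable (\<lambda>i. norm ((1 - q ^ k * (q ^ m) ^ i) - 1))"
    by (simp add: norm_mult norm_power[of "q ^ m"] summable_mult summable_geometric)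
  then have conv: "convergent_prod (\<lambda>i. 1 - q ^ k * (q ^ m) ^ i)"
    by (intro abs_convergent_prod_imp_convergent_prod summable_imp_abs_convergent_prod)
  \<comment> \<open>The products converging to \<open>prodinf\<close> run over
    \<open>i \<le> n\<close>, hence the shift to \<open>Suc n\<close>.\<close>
  have "(\<lambda>n. qpoch (q ^ k) (q ^ m) (Suc n)) \<longlonglongrightarrow> prodinf (\<lambda>i. 1 - q ^ k * (q ^ m) ^ i)"
    using convergent_prod_LIMSEQ[OF conv] by (simp only: qpoch_def lessThan_Suc_atMost)
  moreover have "(\<lambda>n. qpoch (q ^ k) (q ^ m) (Suc n)) \<longlonglongrightarrow> qpoch_inf (q ^ k) (q ^ m)"
    by (rule LIMSEQ_Suc[OF qpoch_tendsto_qpoch_inf[OF qm]])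
  ultimately show ?thesis
    using LIMSEQ_unique prodinf_nonzero[OF conv nz] by metis
qed

lemma qpoch_mult_neg: "qpoch (- a) q n * qpoch a q n = qpoch (a ^ 2) (q ^ 2) n"
  by (simp add: qpoch_def prod.distrib[symmetric] power2_eq_square power_mult_distrib algebra_simps)

text \<open>Factors with even and with odd index are collected separately.\<close>

lemma qpoch_bisect: "qpoch a q (2 * n) = qpoch a (q ^ 2) n * qpoch (a * q) (q ^ 2) n"
  by (induction n) (simp_all add: qpoch_def power_mult[symmetric] power_mult_distrib mult_ac)

lemma qpoch_inf_mult_neg:
  assumes "norm q < 1"
  shows "qpoch_inf (- a) q * qpoch_inf a q = qpoch_inf (a ^ 2) (q ^ 2)"
proof (rule LIMSEQ_unique)
  have "norm (q ^ 2) < 1"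
    using assms by (simp add: norm_power power_less_one_iff)
  then show "(\<lambda>n. qpoch (- a) q n * qpoch a q n) \<longlonglongrightarrow> qpoch_inf (a ^ 2) (q ^ 2)"
    unfolding qpoch_mult_neg by (rule qpoch_tendsto_qpoch_inf)
qed (intro tendsto_mult qpoch_tendsto_qpoch_inf assms)

lemma qpoch_inf_bisect:
  assumes "norm q < 1"
  shows "qpoch_inf a q = qpoch_inf a (q ^ 2) * qpoch_inf (a * q) (q ^ 2)"
proof (rule LIMSEQ_unique)
  have "norm (q ^ 2) < 1"
    using assms by (simp add: norm_power power_less_one_iff)
  then show "(\<lambda>n. qpoch a q (2 * n)) \<longlonglongrightarrow> qpoch_inf a (q ^ 2) * qpoch_inf (a * q) (q ^ 2)"
    unfolding qpoch_bisect by (intro tendsto_mult qpoch_tendsto_qpoch_inf)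
  show "(\<lambda>n. qpoch a q (2 * n)) \<longlonglongrightarrow> qpoch_inf a q"
    using LIMSEQ_subseq_LIMSEQ[OF qpoch_tendsto_qpoch_inf[OF assms], of "\<lambda>n. 2 * n"]
    by (simp add: o_def strict_mono_def)
qed

text \<open>Everything is rewritten to base \<open>q ^ 8\<close>: the numerator is
  \<open>?p 2 / (?p 1 * ?p 5)\<close>, and two rounds of bisection split the denominator into
  \<open>?p 2\<close>, \<open>?p 4\<close>, \<open>?p 6\<close>, \<open>?p 8\<close>. Then
  \<open>?p 2\<close> cancels.\<close>

lemma qpoch_inf_quotient:
  assumes q: "norm q < 1"
  shows "qpoch_inf (- q) (q ^ 4) / qpoch_inf (q ^ 2) (q ^ 2)
    = 1 / qpoch_inf_list [q, q ^ 4, q ^ 5, q ^ 6, q ^ 8] (q ^ 8)"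
proof -
  have small: "norm (q ^ m) < 1" if "m > 0" for m
    using q that by (simp add: norm_power power_less_one_iff)
  let ?p = "\<lambda>k. qpoch_inf (q ^ k) (q ^ 8)"
  have nz: "?p k \<noteq> 0" if "k > 0" for k
    using qpoch_inf_power_nonzero[OF q that] by simp
  have pow: "(q ^ a) ^ b = q ^ (a * b)" "q ^ a * q ^ b = q ^ (a + b)" for a b
    by (simp_all add: power_mult power_add)
  have "qpoch_inf (- q) (q ^ 4) * qpoch_inf q (q ^ 4) = ?p 2"
    using qpoch_inf_mult_neg[OF small[of 4], of q] by (simp add: pow)
  moreover have "qpoch_inf q (q ^ 4) = ?p 1 * ?p 5"
    using qpoch_inf_bisect[OF small[of 4], of q] pow(2)[of 1 4] by (simp add: pow(1))
  moreover have "qpoch_inf (q ^ 2) (q ^ 2) = (?p 2 * ?p 6) * (?p 4 * ?p 8)"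
    using qpoch_inf_bisect[OF small[of 2], of "q ^ 2"] qpoch_inf_bisect[OF small[of 4], of "q ^ 2"]
      qpoch_inf_bisect[OF small[of 4], of "q ^ 4"] by (simp add: pow)
  ultimately show ?thesis
    using nz[of 1] nz[of 2] nz[of 4] nz[of 5] nz[of 6] nz[of 8]
    by (simp add: qpoch_inf_list_def field_simps)
qed

section \<open>Convergence and the sum over all lengths\<close>

lemma chain_weight_tendsto:
  fixes q :: complex
  assumes "norm q < 1"
  shows "chain_weight q \<longlonglongrightarrow> 1 / qpoch_inf_list [q, q ^ 4, q ^ 5, q ^ 6, q ^ 8] (q ^ 8)"
proof -
  have "norm (q ^ m) < 1" if "m > 0" for m
    using assms that by (simp add: norm_power power_less_one_iff)
  then have "(\<lambda>n. qpoch (- q) (q ^ 4) n / qpoch (q ^ 2) (q ^ 2) n)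
      \<longlonglongrightarrow> qpoch_inf (- q) (q ^ 4) / qpoch_inf (q ^ 2) (q ^ 2)"
    by (intro tendsto_divide qpoch_tendsto_qpoch_inf qpoch_inf_power_nonzero assms) auto
  then show ?thesis
    by (simp add: chain_weight_eq_qpoch[abs_def] qpoch_inf_quotient[OF assms])
qed

lemma exact_weight_sums:
  assumes "chain_weight q \<longlonglongrightarrow> L"
  shows "exact_weight q sums L"
  unfolding sums_def by (rule LIMSEQ_imp_Suc) (use assms in \<open>simp only: sum_exact_weight\<close>)

text \<open>The complex limit yields a real one by taking real parts. Each exact weight is a sum of
  nonnegative terms, so convergence of the series is unconditional.\<close>

lemma summable_on_exact_weight_real:
  fixes r :: real
  assumes r: "0 \<le> r" "r < 1"
  shows "exact_weight r summable_on UNIV"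
proof -
  have "chain_weight (complex_of_real r) = (\<lambda>n. complex_of_real (chain_weight r n))"
    by (simp add: chain_weight_def fun_eq_iff)
  moreover obtain L where "chain_weight (complex_of_real r) \<longlonglongrightarrow> L"
    using chain_weight_tendsto[of "complex_of_real r"] r by auto
  ultimately have "chain_weight r \<longlonglongrightarrow> Re L"
    using tendsto_Re by fastforce
  then have "exact_weight r sums Re L"
    by (rule exact_weight_sums)
  moreover have "exact_weight r n \<ge> 0" for n
    using has_sum_positive_chains[of r n] r by (auto elim!: has_sum_nonneg)
  ultimately show ?thesis
    by (simp add: summable_on_UNIV_nonneg_real_iff sums_iff)
qed

text \<open>The real case at \<open>norm q\<close> makes the family of pairs of length and chain
  absolutely summable, so it may be summed by length.\<close>

lemma has_sum_P1:
  fixes q :: complex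
  assumes "norm q < 1"
  defines "L \<equiv> 1 / qpoch_inf_list [q, q ^ 4, q ^ 5, q ^ 6, q ^ 8] (q ^ 8)"
  shows "((\<lambda>l. q ^ sum_list l) has_sum L) P1" and "(exact_weight q has_sum L) UNIV"
proof -
  have "(\<lambda>(n, xs). norm q ^ sum_list xs) summable_on Sigma UNIV positive_chains"
    by (rule summable_on_SigmaI[where g = "exact_weight (norm q)"])
       (use assms has_sum_positive_chains[of "norm q"] summable_on_exact_weight_real[of "norm q"]
        in auto)
  then have sigma: "(\<lambda>(n, xs). q ^ sum_list xs) summable_on Sigma UNIV positive_chains"
    using summable_on_norm_power[of q "\<lambda>p. sum_list (snd p)"] by (simp add: case_prod_unfold)
  then obtain S where S: "((\<lambda>(n, xs). q ^ sum_list xs) has_sum S) (Sigma UNIV positive_chains)"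
    by (auto simp: summable_on_def)
  then have T: "(exact_weight q has_sum S) UNIV"
    by (rule has_sum_SigmaD) (use has_sum_positive_chains[OF assms(1)] in simp)
  \<comment> \<open>The unconditional sum is also the sum in the usual order, which telescopes to
    the limit of \<open>chain_weight\<close>.\<close>
  have "S = L"
    using has_sum_imp_sums[OF T] exact_weight_sums[OF chain_weight_tendsto[OF assms(1)]]
    unfolding L_def by (rule sums_unique2)
  with S T show "(exact_weight q has_sum L) UNIV" "((\<lambda>l. q ^ sum_list l) has_sum L) P1"
    by (auto simp: has_sum_reindex_bij_betw[OF bij_betw_P1, symmetric] case_prod_unfold)
qed

section \<open>The terms of the series\<close>

text \<open>Over the common denominator, the difference of consecutive weights has the factor
  \<open>(1 + q ^ (4 * n + 1)) - (1 - q ^ (2 * n + 2))\<close>.\<close>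

lemma exact_weight_Suc_eq:
  fixes q :: complex
  assumes q: "norm q < 1"
  shows "exact_weight q (Suc n) = qpoch (- q) (q ^ 4) n * q ^ (2 * Suc n)
    * (1 + q powi (2 * int (Suc n) - 3)) / qpoch (q ^ 2) (q ^ 2) (Suc n)"
proof -
  have pow: "q ^ (2 * Suc n) * (1 + q powi (2 * int (Suc n) - 3)) = q ^ (2 * n + 2) + q ^ (4 * n + 1)"
  proof (cases "q = 0")
    case False
    then have "q ^ (2 * n + 2) * q powi (2 * int n - 1) = q powi (int (2 * n + 2) + (2 * int n - 1))"
      by (subst power_int_add) (auto simp flip: power_int_of_nat)
    also have "int (2 * n + 2) + (2 * int n - 1) = int (4 * n + 1)"
      by simp
    finally show ?thesis
      by (simp add: distrib_left flip: power_int_of_nat)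
  qed (cases n; simp)
  let ?A = "qpoch (- q) (q ^ 4) n" and ?B = "qpoch (q ^ 2) (q ^ 2) n"
  have A: "qpoch (- q) (q ^ 4) (Suc n) = ?A * (1 + q ^ (4 * n + 1))"
    by (simp add: qpoch_def power_mult)
  have B: "qpoch (q ^ 2) (q ^ 2) (Suc n) = ?B * (1 - q ^ (2 * n + 2))"
    by (simp add: qpoch_def power_mult power2_eq_square)
  have nz: "?B \<noteq> 0" "1 - q ^ (2 * n + 2) \<noteq> 0"
    using qpoch_power_nonzero[OF q, of 2 2 n] power_neq_1[OF q, of "2 * n + 2"] by auto
  have "exact_weight q (Suc n) = ?A * (q ^ (2 * n + 2) + q ^ (4 * n + 1)) / (?B * (1 - q ^ (2 * n + 2)))"
    using nz unfolding exact_weight_def nat.case chain_weight_eq_qpoch A B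
    by (simp add: divide_simps) (simp add: algebra_simps)
  then show ?thesis
    unfolding B mult.assoc pow .
qed

theorem theorem1p4:
  fixes q :: complex
  assumes "norm q < 1"
  shows "(\<lambda>l. q ^ sum_list l) summable_on P1
    \<and> (\<lambda>n::nat. qpoch (- q) (q ^ 4) (n - 1) * q ^ (2 * n) * (1 + q powi (2 * int n - 3))
          / qpoch (q ^ 2) (q ^ 2) n) summable_on {1..}
    \<and> (\<Sum>\<^sub>\<infinity>l\<in>P1. q ^ sum_list l)
        = 1 + (\<Sum>\<^sub>\<infinity>n::nat\<in>{1..}. qpoch (- q) (q ^ 4) (n - 1) * q ^ (2 * n)
                  * (1 + q powi (2 * int n - 3)) / qpoch (q ^ 2) (q ^ 2) n)
    \<and> 1 + (\<Sum>\<^sub>\<infinity>n::nat\<in>{1..}. qpoch (- q) (q ^ 4) (n - 1) * q ^ (2 * n)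
                  * (1 + q powi (2 * int n - 3)) / qpoch (q ^ 2) (q ^ 2) n)
        = 1 / qpoch_inf_list [q, q ^ 4, q ^ 5, q ^ 6, q ^ 8] (q ^ 8)"
proof -
  define L where "L = 1 / qpoch_inf_list [q, q ^ 4, q ^ 5, q ^ 6, q ^ 8] (q ^ 8)"
  define t where "t = (\<lambda>n::nat. qpoch (- q) (q ^ 4) (n - 1) * q ^ (2 * n)
    * (1 + q powi (2 * int n - 3)) / qpoch (q ^ 2) (q ^ 2) n)"
  have P1: "((\<lambda>l. q ^ sum_list l) has_sum L) P1" and all: "(exact_weight q has_sum L) UNIV"
    using has_sum_P1[OF assms] unfolding L_def by auto
  have "(exact_weight q has_sum 1) {0}"
    by (simp add: has_sum_finiteI exact_weight_def)
  \<comment> \<open>Splitting off the empty partition produces the leading 1; the formula for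
    \<open>t\<close> is used only from \<open>n = 1\<close> on.\<close>
  then have "(exact_weight q has_sum (L - 1)) (UNIV - {0})"
    by (intro has_sum_Diff all) auto
  moreover have "exact_weight q n = t n" if "n \<noteq> 0" for n
    using that exact_weight_Suc_eq[OF assms, of "n - 1"] unfolding t_def by simp
  ultimately have "(t has_sum (L - 1)) (UNIV - {0})"
    by (subst has_sum_cong[where g = "exact_weight q"]) auto
  moreover have "UNIV - {0::nat} = {1..}"
    by auto
  ultimately have t: "(t has_sum (L - 1)) {1..}"
    by simp
  have "(\<lambda>l. q ^ sum_list l) summable_on P1 \<and> t summable_on {1..}
    \<and> (\<Sum>\<^sub>\<infinity>l\<in>P1. q ^ sum_list l) = 1 + infsum t {1..} \<and> 1 + infsum t {1..} = L"
    using P1 t infsumI[OF P1] infsumI[OF t] by (auto dest: has_sum_imp_summable)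
  then show ?thesis
    unfolding t_def L_def .
qed

end
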